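(* Let $\{B_s\}_{s\in\mathcal S}$ be a family of matrices, $B_s\in\mathbb C^{n_s\times n_s}$, and let $\{G_s\}_{s\in\mathcal S}$ be a family of graphs, where $G_s$ has vertex set $\{1,\dots,n_s\}$ and geodesic distance $\mathrm d_s$. Assume that there are constants $C>0$ and $q\in(0,1)$, independent of $s$, such that $$|[B_s]_{ij}|\le C\,q^{\mathrm d_s(i,j)}\qquad\text{for all } i,j\in\{1,\dots,n_s\},\ s\in\mathcal S .$$ Assume further that there are constants $K>0$ and $\alpha>0$, independent of $s$ and $j$, such that the level sets satisfy $$|L_s^{(\delta)}(j)|\le K\,\delta^{\alpha}\qquad\text{for all } s\in\mathcal S,\ j\in\{1,\dots,n_s\},\ \delta=1,\dots,n_s-1 .$$ For $m>0$ define $B_s^{(m)}\in\mathbb C^{n_s\times n_s}$ by $[B_s^{(m)}]_{ij}=[B_s]_{ij}$ if $\mathrm d_s(i,j)\le m$ and $[B_s^{(m)}]_{ij}=0$ otherwise. Then for every $\varepsilon>0$ there exists $\widetilde m$, independent of $s$, such that $$\|B_s-B_s^{(m)}\|_1<\varepsilon\qquad\text{for all } m>\widetilde m \text{ and all } s\in\mathcal S .$$ Moreover, for any fixed $m>\widetilde m$ the matrices $B_s^{(m)}$ contain $\mathcal O(n_s)$ nonzeros, i.e., there is a constant $c$ independent of $s$ such that $B_s^{(m)}$ has at most $c\,n_s$ nonzero entries for all $s\in\mathcal S$.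
   Context: The geodesic distance $\mathrm d_s(i,j)$ is the length of a shortest path from node $i$ to node $j$ in $G_s$, with $\mathrm d_s(i,i)=0$ and $\mathrm d_s(i,j)=\infty$ if there is no such path; $q^{\infty}:=0$. The level sets of a node $j$ are $L_s^{(\delta)}(j)=\{i:\mathrm d_s(i,j)=\delta\}$ for $\delta=0,\dots,n_s-1$. $\|\cdot\|_1$ is the matrix norm induced by the vector 1-norm (maximum absolute column sum). *)

theory Defs
  imports
    Complex_Main
    "HOL-Library.Extended_Real"
    "Jordan_Normal_Form.Matrix"
    "Graph_Theory.Pair_Digraph"
begin

(* Graphs are directed graphs without parallel arcs (loops allowed); an undirected graph is
   the special case of a symmetric arc set.  The infimum over the empty set is \<infinity>, which is the
   value for a pair of nodes not joined by a path. *)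
definition geodesic_dist :: "'a pair_pre_digraph \<Rightarrow> 'a \<Rightarrow> 'a \<Rightarrow> enat" where
  "geodesic_dist G i j = (INF p \<in> {p. pre_digraph.apath (with_proj G) i p j}. enat (length p))"

definition level_set :: "'a pair_pre_digraph \<Rightarrow> nat \<Rightarrow> 'a \<Rightarrow> 'a set" where
  "level_set G \<delta> j = {i \<in> pverts G. geodesic_dist G i j = enat \<delta>}"

definition enat_power :: "real \<Rightarrow> enat \<Rightarrow> real" where
  "enat_power q d = (case d of enat k \<Rightarrow> q ^ k | \<infinity> \<Rightarrow> 0)"

definition vec_norm1 :: "complex vec \<Rightarrow> real" where
  "vec_norm1 v = (\<Sum>i<dim_vec v. cmod (v $ i))"

(* Taking the unit ball instead of the unit sphere only matters for matrices without columns,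
   where the sphere is empty; the norm is then 0. *)
definition mat_norm1 :: "complex mat \<Rightarrow> real" where
  "mat_norm1 A = (SUP v \<in> {v \<in> carrier_vec (dim_col A). vec_norm1 v \<le> 1}. vec_norm1 (A *\<^sub>v v))"

(* Rows and columns of a matrix are indexed from 0, so the nodes are 0, ..., n - 1. *)
definition truncate_mat :: "nat pair_pre_digraph \<Rightarrow> real \<Rightarrow> complex mat \<Rightarrow> complex mat" where
  "truncate_mat G m A = mat (dim_row A) (dim_col A)
     (\<lambda>(i, j). if ereal_of_enat (geodesic_dist G i j) \<le> ereal m then A $$ (i, j) else 0)"

definition nonzeros :: "complex mat \<Rightarrow> (nat \<times> nat) set" where
  "nonzeros A = {(i, j). i < dim_row A \<and> j < dim_col A \<and> A $$ (i, j) \<noteq> 0}"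

lemma geodesic_dist_self: "i \<in> pverts G \<Longrightarrow> geodesic_dist G i i = 0"
proof -
  assume "i \<in> pverts G"
  then have "pre_digraph.apath (with_proj G) i [] i"
    by (simp add: pre_digraph.apath_def pre_digraph.awalk_def pre_digraph.cas.simps
        pre_digraph.awalk_verts.simps)
  then have "geodesic_dist G i i \<le> enat (length ([] :: ('a \<times> 'a) list))"
    unfolding geodesic_dist_def by (intro INF_lower) simp
  then show ?thesis by (simp add: zero_enat_def[symmetric])
qed

lemma geodesic_dist_eq_infinity_iff:
  "geodesic_dist G i j = \<infinity> \<longleftrightarrow> (\<nexists>p. pre_digraph.apath (with_proj G) i p j)"
proof
  assume inf: "geodesic_dist G i j = \<infinity>"
  show "\<nexists>p. pre_digraph.apath (with_proj G) i p j"
  proof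
    assume "\<exists>p. pre_digraph.apath (with_proj G) i p j"
    then obtain p where p: "pre_digraph.apath (with_proj G) i p j" by blast
    have "geodesic_dist G i j \<le> enat (length p)"
      unfolding geodesic_dist_def using p by (intro INF_lower) simp
    with inf show False by simp
  qed
next
  assume "\<nexists>p. pre_digraph.apath (with_proj G) i p j"
  then show "geodesic_dist G i j = \<infinity>"
    by (simp add: geodesic_dist_def top_enat_def)
qed

lemma vec_norm1_nonneg: "0 \<le> vec_norm1 v"
  by (simp add: vec_norm1_def sum_nonneg)

lemma mat_norm1_eq_Max_column_sum:
  assumes "0 < dim_col A"
  shows "mat_norm1 A = (MAX j\<in>{..<dim_col A}. \<Sum>i<dim_row A. cmod (A $$ (i, j)))"
proof -
  let ?c = "\<lambda>j. \<Sum>i<dim_row A. cmod (A $$ (i, j))"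
  let ?M = "MAX j\<in>{..<dim_col A}. ?c j"
  let ?V = "{v \<in> carrier_vec (dim_col A). vec_norm1 v \<le> 1}"
  have c_le: "?c j \<le> ?M" if "j < dim_col A" for j
    using that by (intro Max_ge) auto
  have M0: "0 \<le> ?M"
    using c_le[OF assms] by (meson order_trans sum_nonneg norm_ge_zero)
  have upper: "vec_norm1 (A *\<^sub>v v) \<le> ?M" if v: "v \<in> ?V" for v
  proof -
    from v have dim: "dim_vec v = dim_col A" and le1: "vec_norm1 v \<le> 1" by auto
    have entry: "(A *\<^sub>v v) $ i = (\<Sum>j<dim_col A. A $$ (i, j) * v $ j)"
      if "i < dim_row A" for i
      using that dim by (auto simp: scalar_prod_def atLeast0LessThan intro!: sum.cong)
    have "vec_norm1 (A *\<^sub>v v) = (\<Sum>i<dim_row A. cmod (\<Sum>j<dim_col A. A $$ (i, j) * v $ j))"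
      unfolding vec_norm1_def using entry by simp
    also have "\<dots> \<le> (\<Sum>i<dim_row A. \<Sum>j<dim_col A. cmod (A $$ (i, j)) * cmod (v $ j))"
      by (intro sum_mono sum_norm_le) (simp add: norm_mult)
    also have "\<dots> = (\<Sum>j<dim_col A. ?c j * cmod (v $ j))"
      by (subst sum.swap) (simp add: sum_distrib_right)
    also have "\<dots> \<le> (\<Sum>j<dim_col A. ?M * cmod (v $ j))"
      using c_le by (intro sum_mono mult_right_mono) auto
    also have "\<dots> = ?M * vec_norm1 v"
      by (simp add: vec_norm1_def dim sum_distrib_left)
    also have "\<dots> \<le> ?M * 1"
      using M0 le1 by (intro mult_left_mono) auto
    finally show ?thesis by simp
  qed
  have "?M \<in> ?c ` {..<dim_col A}"
    using assms by (intro Max_in) auto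
  then obtain j where j: "j < dim_col A" "?M = ?c j" by auto
  let ?e = "unit_vec (dim_col A) j :: complex vec"
  have "vec_norm1 ?e = (\<Sum>i<dim_col A. if i = j then 1 else 0)"
    unfolding vec_norm1_def using j by (intro sum.cong) auto
  then have e: "?e \<in> ?V" using j by simp
  have "vec_norm1 (A *\<^sub>v ?e) = ?M"
    using j by (auto simp: vec_norm1_def intro!: sum.cong)
  with e upper show ?thesis
    unfolding mat_norm1_def by (intro cSup_eq_maximum) force+
qed

end

theory Submission
  imports Defs "HOL-Analysis.Summation_Tests" "HOL-Real_Asymp.Real_Asymp"
begin

text \<open>Group the entries of column j by the distance k from row node to j. Each is at most C
  q^k in modulus and level k holds at most K k^\<alpha> nodes, so level k adds at most
  \<open>a k\<close> = C K k^\<alpha> q^k to the column sum, uniformly in s and j. Geometric decay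
  beats polynomial growth (\<open>summable_powr_times_geometric\<close>), so these terms have small
  tails. Truncation leaves only levels beyond m in the error, and its 1-norm, a maximal column sum,
  is bounded by such a tail (\<open>sum_by_level\<close>, \<open>mat_norm1_le\<close>). For
  sparsity, nonzeros of a truncated column lie in the levels up to m, whose total size is bounded
  independently of s and j. \<open>geodesic_dist_less_card\<close> shows that levels from n_s on are
  empty, so the growth hypothesis covers every positive level that matters.\<close>

text \<open>The infimum is attained because \<open>enat\<close> is well-ordered; a finite value
  rules out the empty set of paths.\<close>

lemma geodesic_dist_eq_enatD:
  assumes "geodesic_dist G i j = enat k"
  shows "\<exists>p. pre_digraph.apath (with_proj G) i p j \<and> length p = k"
proof -
  let ?P = "{p. pre_digraph.apath (with_proj G) i p j}"
  let ?L = "(\<lambda>p. enat (length p)) ` ?P"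
  have "?L \<noteq> {}"
    using assms geodesic_dist_eq_infinity_iff[of G i j] by auto
  then have "Inf ?L \<in> ?L"
    by (auto simp: Inf_enat_def simp del: image_is_empty intro: LeastI)
  then show ?thesis
    using assms by (auto simp: geodesic_dist_def)
qed

lemma geodesic_dist_eq_0D:
  assumes "geodesic_dist G i j = enat 0"
  shows "i = j"
  using geodesic_dist_eq_enatD[OF assms]
  by (auto simp: pre_digraph.apath_def pre_digraph.awalk_def pre_digraph.cas.simps)

text \<open>A path of length k visits k + 1 distinct vertices.\<close>

lemma (in pair_wf_digraph) geodesic_dist_less_card:
  assumes fin: "finite (pverts G)" and d: "geodesic_dist G i j = enat k"
  shows "k < card (pverts G)"
proof -
  obtain p where p: "apath i p j" "length p = k"
    using geodesic_dist_eq_enatD[OF d] by blast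
  then have dist: "distinct (awalk_verts i p)" and aw: "awalk i p j"
    by (auto simp: apath_def)
  have "Suc k = card (set (awalk_verts i p))"
    using dist p by (simp add: distinct_card length_awalk_verts)
  also have "\<dots> \<le> card (pverts G)"
    using awalk_verts_in_verts aw fin by (intro card_mono) (auto simp: awalk_def)
  finally show ?thesis by simp
qed

text \<open>Unlike the maximum formula, this also covers a matrix without columns, where the
  supremum runs over the empty vector alone and equals 0.\<close>

lemma mat_norm1_le:
  assumes col: "\<And>j. j < dim_col A \<Longrightarrow> (\<Sum>i<dim_row A. cmod (A $$ (i, j))) \<le> c" and "0 \<le> c"
  shows "mat_norm1 A \<le> c"
proof (cases "dim_col A = 0")
  case True
  have "vec_norm1 (A *\<^sub>v v) = 0" if "v \<in> carrier_vec 0" for v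
    using that True by (auto simp: vec_norm1_def scalar_prod_def)
  moreover have "0\<^sub>v 0 \<in> {v \<in> carrier_vec 0. vec_norm1 v \<le> 1}"
    by (auto simp: vec_norm1_def)
  then have "{v \<in> carrier_vec 0. vec_norm1 v \<le> 1} \<noteq> {}"
    by blast
  ultimately show ?thesis
    unfolding mat_norm1_def using True \<open>0 \<le> c\<close> by (intro cSUP_least) auto
next
  case False
  then show ?thesis
    using col by (subst mat_norm1_eq_Max_column_sum) (auto simp: lessThan_empty_iff)
qed

text \<open>Comparison with the convergent series of 1/k^2.\<close>

lemma summable_powr_times_geometric:
  fixes q a :: real
  assumes "0 < q" "q < 1"
  shows "summable (\<lambda>k. real k powr a * q ^ k)"
proof (rule summable_comparison_test_bigo)
  show "summable (\<lambda>k. norm (inverse (real k ^ 2)))"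
    using inverse_power_summable[of 2, where ?'a = real] by simp
  show "(\<lambda>k. real k powr a * q ^ k) \<in> O(\<lambda>k. inverse (real k ^ 2))"
    using assms by real_asymp
qed

text \<open>Level sets of distinct k are disjoint. Only finite distances occur in the index set, so
  \<open>the_enat\<close> is never applied to infinity.\<close>

lemma sum_by_level:
  fixes f :: "nat \<Rightarrow> real"
  assumes "finite (pverts G)" "finite D"
  shows "(\<Sum>i | i \<in> pverts G \<and> (\<exists>k\<in>D. geodesic_dist G i j = enat k). f (the_enat (geodesic_dist G i j)))
    = (\<Sum>k\<in>D. real (card (level_set G k j)) * f k)"
proof -
  have eq: "{i. i \<in> pverts G \<and> (\<exists>k\<in>D. geodesic_dist G i j = enat k)} = (\<Union>k\<in>D. level_set G k j)"
    by (auto simp: level_set_def)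
  have "(\<Sum>i\<in>(\<Union>k\<in>D. level_set G k j). f (the_enat (geodesic_dist G i j))) =
    (\<Sum>k\<in>D. \<Sum>i\<in>level_set G k j. f (the_enat (geodesic_dist G i j)))"
    using assms by (intro sum.UNION_disjoint) (auto simp: level_set_def)
  also have "\<dots> = (\<Sum>k\<in>D. real (card (level_set G k j)) * f k)"
  proof (rule sum.cong[OF refl])
    fix k
    have "(\<Sum>i\<in>level_set G k j. f (the_enat (geodesic_dist G i j))) = (\<Sum>i\<in>level_set G k j. f k)"
      by (rule sum.cong) (auto simp: level_set_def)
    then show "(\<Sum>i\<in>level_set G k j. f (the_enat (geodesic_dist G i j))) = real (card (level_set G k j)) * f k"
      by simp
  qed
  finally show ?thesis by (simp only: eq)
qed

theorem theorem3p3: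
  fixes S :: "'s set"
    and n :: "'s \<Rightarrow> nat"
    and B :: "'s \<Rightarrow> complex mat"
    and G :: "'s \<Rightarrow> nat pair_pre_digraph"
    and C q K \<alpha> :: real
  assumes B_dim: "\<And>s. s \<in> S \<Longrightarrow> B s \<in> carrier_mat (n s) (n s)"
    and graph: "\<And>s. s \<in> S \<Longrightarrow> pair_wf_digraph (G s)"
    and vertices: "\<And>s. s \<in> S \<Longrightarrow> pverts (G s) = {0..<n s}"
    and C_pos: "C > 0"
    and q_range: "q \<in> {0<..<1}"
    and decay: "\<And>s i j. s \<in> S \<Longrightarrow> i < n s \<Longrightarrow> j < n s \<Longrightarrow>
      cmod (B s $$ (i, j)) \<le> C * enat_power q (geodesic_dist (G s) i j)"
    and K_pos: "K > 0"
    and \<alpha>_pos: "\<alpha> > 0"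
    and levels: "\<And>s j \<delta>. s \<in> S \<Longrightarrow> j < n s \<Longrightarrow> \<delta> \<in> {1..n s - 1} \<Longrightarrow>
      real (card (level_set (G s) \<delta> j)) \<le> K * real \<delta> powr \<alpha>"
  shows "\<forall>\<epsilon>>0. \<exists>m0\<ge>0.
      (\<forall>m>m0. \<forall>s\<in>S. mat_norm1 (B s - truncate_mat (G s) m (B s)) < \<epsilon>) \<and>
      (\<forall>m>m0. \<exists>c. \<forall>s\<in>S.
         real (card (nonzeros (truncate_mat (G s) m (B s)))) \<le> c * real (n s))"
proof (intro allI impI)
  fix \<epsilon> :: real assume "\<epsilon> > 0"
  have q: "0 < q" "q < 1" using q_range by auto
  define a where "a k = C * (K * real k powr \<alpha> * q ^ k)" for k
  have a_nonneg: "0 \<le> a k" for k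
    using C_pos K_pos q by (simp add: a_def)
  have "summable a"
    unfolding a_def mult.assoc
    by (intro summable_mult summable_powr_times_geometric q)
  \<comment> \<open>Cauchy criterion, with N depending only on \<open>a\<close> and \<epsilon>,
    hence not on s. The half keeps the final inequality strict after passing to the supremum in the
    norm.\<close>
  then obtain N where N: "\<And>k. norm (sum a {N..<k}) < \<epsilon> / 2"
    using \<open>\<epsilon> > 0\<close> unfolding summable_Cauchy by (metis half_gt_zero order_refl)
  have vanish: "k < n s" if "s \<in> S" "geodesic_dist (G s) i j = enat k" for s i j k
    using pair_wf_digraph.geodesic_dist_less_card[OF graph _ that(2)] that(1) by (simp add: vertices)
  have "mat_norm1 (B s - truncate_mat (G s) m (B s)) < \<epsilon>" if m: "real N < m" and s: "s \<in> S" for m s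
  proof -
    define A where "A = B s - truncate_mat (G s) m (B s)"
    have dim: "dim_row A = n s" "dim_col A = n s"
      using B_dim[OF s] by (auto simp: A_def truncate_mat_def)
    have "(\<Sum>i<n s. cmod (A $$ (i, j))) \<le> \<epsilon> / 2" if j: "j < n s" for j
    proof -
      let ?d = "\<lambda>i. geodesic_dist (G s) i j"
      let ?D = "{N<..<n s}"
      let ?I = "{i. i \<in> pverts (G s) \<and> (\<exists>k\<in>?D. ?d i = enat k)}"
      \<comment> \<open>At distance at most N < m the truncation keeps the entry, so the difference
        is 0; at infinite distance the entry of \<open>B s\<close> itself vanishes, since
        q^\<infinity> = 0.\<close>
      have zero: "A $$ (i, j) = 0" if "i < n s" "i \<notin> ?I" for i
      proof (cases "?d i")
        case (enat k)
        with that vanish[OF s enat] have "k \<le> N"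
          by (auto simp: vertices[OF s])
        then show ?thesis
          using that j m enat B_dim[OF s] by (auto simp: A_def truncate_mat_def)
      next
        case infinity
        then show ?thesis
          using that j m decay[OF s that(1) j] B_dim[OF s]
          by (auto simp: A_def truncate_mat_def enat_power_def)
      qed
      have bound: "cmod (A $$ (i, j)) \<le> C * q ^ the_enat (?d i)" if "i \<in> ?I" for i
      proof -
        from that have i: "i < n s" by (auto simp: vertices[OF s])
        have "cmod (A $$ (i, j)) \<le> cmod (B s $$ (i, j))"
          using i j B_dim[OF s] by (auto simp: A_def truncate_mat_def)
        also have "\<dots> \<le> C * q ^ the_enat (?d i)"
          using decay[OF s i j] that by (auto simp: enat_power_def)
        finally show ?thesis .
      qed
      have "(\<Sum>i<n s. cmod (A $$ (i, j))) = (\<Sum>i\<in>?I. cmod (A $$ (i, j)))"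
        using zero by (intro sum.mono_neutral_right) (auto simp: vertices[OF s])
      also have "\<dots> \<le> (\<Sum>i\<in>?I. C * q ^ the_enat (?d i))"
        using bound by (rule sum_mono)
      also have "\<dots> = (\<Sum>k\<in>?D. real (card (level_set (G s) k j)) * (C * q ^ k))"
        by (rule sum_by_level) (auto simp: vertices[OF s])
      \<comment> \<open>Every k in \<open>?D\<close> satisfies N < k < n_s, so k lies in the range
        1, ..., n_s - 1 of the growth hypothesis even if N = 0.\<close>
      also have "\<dots> \<le> (\<Sum>k\<in>?D. (K * real k powr \<alpha>) * (C * q ^ k))"
        using C_pos q by (intro sum_mono mult_right_mono levels[OF s j]) auto
      also have "\<dots> = sum a ?D"
        by (simp add: a_def mult_ac)
      also have "\<dots> \<le> sum a {N..<n s}"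
        using a_nonneg by (intro sum_mono2) auto
      also have "\<dots> \<le> \<epsilon> / 2"
        using N[of "n s"] by simp
      finally show ?thesis .
    qed
    then have "mat_norm1 A \<le> \<epsilon> / 2"
      using \<open>\<epsilon> > 0\<close> by (intro mat_norm1_le) (auto simp: dim)
    then show ?thesis
      using \<open>\<epsilon> > 0\<close> by (simp add: A_def)
  qed
  moreover have "\<exists>c. \<forall>s\<in>S. real (card (nonzeros (truncate_mat (G s) m (B s)))) \<le> c * real (n s)"
    if m: "real N < m" for m
  proof (intro exI ballI)
    fix s assume s: "s \<in> S"
    let ?M = "nat \<lfloor>m\<rfloor>"
    \<comment> \<open>Bound for the number of nodes within distance m of any node; it mentions
      neither s nor j. Level 0 is counted separately because K * 0 powr \<alpha> = 0, while that
      level contains j itself.\<close>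
    let ?c = "\<Sum>k\<le>?M. if k = 0 then 1 else K * real k powr \<alpha>"
    let ?L = "\<lambda>j. \<Union>k\<le>?M. level_set (G s) k j"
    have fin: "finite (level_set (G s) k j)" for k j
      by (simp add: level_set_def vertices[OF s])
    have level: "real (card (level_set (G s) k j)) \<le> (if k = 0 then 1 else K * real k powr \<alpha>)"
      if j: "j < n s" for k j
    proof -
      consider "k = 0" | "k \<in> {1..n s - 1}" | "k \<ge> n s" by fastforce
      then show ?thesis
      proof cases
        case 1
        have "level_set (G s) 0 j \<subseteq> {j}"
          using geodesic_dist_eq_0D by (auto simp: level_set_def)
        then have "card (level_set (G s) 0 j) \<le> card {j}"
          by (intro card_mono) auto
        with 1 show ?thesis by simp
      next
        case 2
        then show ?thesis using levels[OF s j] by auto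
      next
        case 3
        then have "level_set (G s) k j = {}"
          using vanish[OF s] by (fastforce simp: level_set_def)
        then show ?thesis using K_pos by simp
      qed
    qed
    \<comment> \<open>Distances are integers, so being at most m means being at most
      \<open>?M\<close>; column j thus has its nonzeros in rows from \<open>?L j\<close>.\<close>
    have "nonzeros (truncate_mat (G s) m (B s)) \<subseteq> (\<Union>j<n s. ?L j \<times> {j})"
    proof clarify
      fix i j assume ij: "(i, j) \<in> nonzeros (truncate_mat (G s) m (B s))"
      then have lt: "i < n s" "j < n s" and d: "ereal_of_enat (geodesic_dist (G s) i j) \<le> ereal m"
        using B_dim[OF s] by (auto simp: nonzeros_def truncate_mat_def split: if_splits)
      from d obtain k where k: "geodesic_dist (G s) i j = enat k" "real k \<le> m"
        by (cases "geodesic_dist (G s) i j") auto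
      then have "k \<le> ?M" by (simp add: le_nat_floor)
      then show "(i, j) \<in> (\<Union>j<n s. ?L j \<times> {j})"
        using k lt by (auto simp: level_set_def vertices[OF s])
    qed
    then have "card (nonzeros (truncate_mat (G s) m (B s))) \<le> card (\<Union>j<n s. ?L j \<times> {j})"
      using fin by (intro card_mono) auto
    also have "\<dots> \<le> (\<Sum>j<n s. card (?L j \<times> {j}))"
      by (rule card_UN_le) simp
    also have "\<dots> \<le> (\<Sum>j<n s. \<Sum>k\<le>?M. card (level_set (G s) k j))"
      by (intro sum_mono) (simp add: card_cartesian_product card_UN_le)
    finally have "real (card (nonzeros (truncate_mat (G s) m (B s))))
        \<le> (\<Sum>j<n s. \<Sum>k\<le>?M. real (card (level_set (G s) k j)))"
      by (simp flip: of_nat_sum)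
    also have "\<dots> \<le> (\<Sum>j<n s. ?c)"
      using level by (intro sum_mono) auto
    finally show "real (card (nonzeros (truncate_mat (G s) m (B s)))) \<le> ?c * real (n s)"
      by (simp add: mult.commute)
  qed
  ultimately show "\<exists>m0\<ge>0.
      (\<forall>m>m0. \<forall>s\<in>S. mat_norm1 (B s - truncate_mat (G s) m (B s)) < \<epsilon>) \<and>
      (\<forall>m>m0. \<exists>c. \<forall>s\<in>S.
         real (card (nonzeros (truncate_mat (G s) m (B s)))) \<le> c * real (n s))"
    by (intro exI[of _ "real N"]) auto
qed

end
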